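(* Let $\alpha,\beta,\gamma\in[0,\infty)$ and consider the hyperelastic compressible plate model $$\bigl(u_t-u_{xxt}+3uu_x-\gamma(2u_xu_{xx}+uu_{xxx})\bigr)_x-\alpha u_{yy}+\beta u_{xxyy}=0$$ for real-valued $u=u(t,x,y)$, $(t,x,y)\in I\times\mathbb{R}^2$. Assume that this equation has a unique classical solution $u(t,x,y)$, $(t,x,y)\in I\times\mathbb{R}^2$, for the given initial data $u_0(x,y)=u(0,x,y)$. If $u$ is $x$-symmetric with axis of symmetry $\lambda=\lambda(t)$, then $u$ is a steady solution in the $x$-direction with speed $\dot\lambda(0)$; that is, there exists a function $g$ such that $u(t,x,y)=g(x-\dot\lambda(0)t,\,y)$ for all $(t,x,y)\in I\times\mathbb{R}^2$.
   Context: $I=[0,T]$ with $T>0$ is an interval of existence of the equation. A classical solution is a function on $I\times\mathbb{R}^2$ for which all partial derivatives occurring in the equation exist and are continuous and which satisfies the equation pointwise. A function $f(t,x,y)$, $(t,x,y)\in I\times\mathbb{R}^2$, is called $x$-symmetric if there exists a function $\lambda\in C^1(\mathbb{R})$ such that $f(t,x,y)=f(t,2\lambda(t)-x,y)$ for all $(t,x,y)\in I\times\mathbb{R}^2$; $\lambda$ is called the axis of symmetry, and $\dot\lambda$ denotes its derivative. A function $f(t,x,y)$ is called steady in the $x$-direction (with speed $c\in\mathbb{R}$) if there exists a function $g$ such that $f(t,x,y)=g(x-ct,y)$ for all $(t,x,y)\in I\times\mathbb{R}^2$. *)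

theory Defs
  imports "HOL-Analysis.Analysis"
begin

text \<open>
  A function on \<open>{0..T} \<times> \<real>\<^sup>2\<close> is represented by a curried total function \<open>f t x y\<close>, of which only
  the values with \<open>t \<in> {0..T}\<close> are ever used. In particular time derivatives are taken within
  \<open>{0..T}\<close>, hence one-sided at the two endpoints.
\<close>

type_synonym field3 = "real \<Rightarrow> real \<Rightarrow> real \<Rightarrow> real"

definition Dt :: "real \<Rightarrow> field3 \<Rightarrow> field3" where
  "Dt T f t x y = vector_derivative (\<lambda>s. f s x y) (at t within {0..T})"

definition Dx :: "field3 \<Rightarrow> field3" where
  "Dx f t x y = deriv (\<lambda>s. f t s y) x"

definition Dy :: "field3 \<Rightarrow> field3" where
  "Dy f t x y = deriv (\<lambda>s. f t x s) y"

definition has_Dt :: "real \<Rightarrow> field3 \<Rightarrow> bool" where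
  "has_Dt T f \<longleftrightarrow> (\<forall>t\<in>{0..T}. \<forall>x y. (\<lambda>s. f s x y) differentiable (at t within {0..T}))"

definition has_Dx :: "real \<Rightarrow> field3 \<Rightarrow> bool" where
  "has_Dx T f \<longleftrightarrow> (\<forall>t\<in>{0..T}. \<forall>x y. (\<lambda>s. f t s y) differentiable (at x))"

definition has_Dy :: "real \<Rightarrow> field3 \<Rightarrow> bool" where
  "has_Dy T f \<longleftrightarrow> (\<forall>t\<in>{0..T}. \<forall>x y. (\<lambda>s. f t x s) differentiable (at y))"

definition cont :: "real \<Rightarrow> field3 \<Rightarrow> bool" where
  "cont T f \<longleftrightarrow> continuous_on ({0..T} \<times> UNIV) (\<lambda>(t, x, y). f t x y)"

text \<open>
  Subscripts are read from left to right: \<open>u\<^sub>x\<^sub>x\<^sub>t\<close> is \<open>Dt T (Dx (Dx u))\<close>. The derivatives occurring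
  in the equation are those obtained by carrying out the outer \<open>x\<close>-derivative, namely
  \<open>u\<^sub>t\<close>, \<open>u\<^sub>t\<^sub>x\<close>, \<open>u\<^sub>x\<close>, \<open>u\<^sub>x\<^sub>x\<close>, \<open>u\<^sub>x\<^sub>x\<^sub>x\<close>, \<open>u\<^sub>x\<^sub>x\<^sub>x\<^sub>x\<close>, \<open>u\<^sub>x\<^sub>x\<^sub>t\<close>, \<open>u\<^sub>x\<^sub>x\<^sub>t\<^sub>x\<close>, \<open>u\<^sub>y\<^sub>y\<close>, \<open>u\<^sub>x\<^sub>x\<^sub>y\<^sub>y\<close>. They are required
  irrespective of whether some of the coefficients vanish.
\<close>

definition classical_regularity :: "real \<Rightarrow> field3 \<Rightarrow> bool" where
  "classical_regularity T u \<longleftrightarrow>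
     cont T u \<and>
     has_Dt T u \<and> cont T (Dt T u) \<and>
     has_Dx T (Dt T u) \<and> cont T (Dx (Dt T u)) \<and>
     has_Dx T u \<and> cont T (Dx u) \<and>
     has_Dx T (Dx u) \<and> cont T (Dx (Dx u)) \<and>
     has_Dx T (Dx (Dx u)) \<and> cont T (Dx (Dx (Dx u))) \<and>
     has_Dx T (Dx (Dx (Dx u))) \<and> cont T (Dx (Dx (Dx (Dx u)))) \<and>
     has_Dt T (Dx (Dx u)) \<and> cont T (Dt T (Dx (Dx u))) \<and>
     has_Dx T (Dt T (Dx (Dx u))) \<and> cont T (Dx (Dt T (Dx (Dx u)))) \<and>
     has_Dy T u \<and> has_Dy T (Dy u) \<and> cont T (Dy (Dy u)) \<and>
     has_Dy T (Dx (Dx u)) \<and> has_Dy T (Dy (Dx (Dx u))) \<and> cont T (Dy (Dy (Dx (Dx u))))"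

definition plate_equation_at ::
    "real \<Rightarrow> real \<Rightarrow> real \<Rightarrow> real \<Rightarrow> field3 \<Rightarrow> real \<Rightarrow> real \<Rightarrow> real \<Rightarrow> bool" where
  "plate_equation_at \<alpha> \<beta> \<gamma> T u t x y \<longleftrightarrow>
     Dx (\<lambda>t x y. Dt T u t x y - Dt T (Dx (Dx u)) t x y + 3 * u t x y * Dx u t x y
           - \<gamma> * (2 * Dx u t x y * Dx (Dx u) t x y + u t x y * Dx (Dx (Dx u)) t x y)) t x y
       - \<alpha> * Dy (Dy u) t x y + \<beta> * Dy (Dy (Dx (Dx u))) t x y = 0"

definition classical_solution ::
    "real \<Rightarrow> real \<Rightarrow> real \<Rightarrow> real \<Rightarrow> field3 \<Rightarrow> bool" where
  "classical_solution \<alpha> \<beta> \<gamma> T u \<longleftrightarrow>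
     classical_regularity T u \<and> (\<forall>t\<in>{0..T}. \<forall>x y. plate_equation_at \<alpha> \<beta> \<gamma> T u t x y)"

definition unique_classical_solution ::
    "real \<Rightarrow> real \<Rightarrow> real \<Rightarrow> real \<Rightarrow> (real \<Rightarrow> real \<Rightarrow> real) \<Rightarrow> field3 \<Rightarrow> bool" where
  "unique_classical_solution \<alpha> \<beta> \<gamma> T u0 u \<longleftrightarrow>
     classical_solution \<alpha> \<beta> \<gamma> T u \<and> (\<forall>x y. u 0 x y = u0 x y) \<and>
     (\<forall>v. classical_solution \<alpha> \<beta> \<gamma> T v \<and> (\<forall>x y. v 0 x y = u0 x y) \<longrightarrow>
        (\<forall>t\<in>{0..T}. \<forall>x y. v t x y = u t x y))"

definition x_symmetric_with_axis :: "real \<Rightarrow> field3 \<Rightarrow> (real \<Rightarrow> real) \<Rightarrow> bool" where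
  "x_symmetric_with_axis T f ax \<longleftrightarrow>
     ax C1_differentiable_on UNIV \<and>
     (\<forall>t\<in>{0..T}. \<forall>x y. f t x y = f t (2 * ax t - x) y)"

definition steady_in_x :: "real \<Rightarrow> field3 \<Rightarrow> real \<Rightarrow> bool" where
  "steady_in_x T f c \<longleftrightarrow>
     (\<exists>g :: real \<Rightarrow> real \<Rightarrow> real. \<forall>t\<in>{0..T}. \<forall>x y. f t x y = g (x - c * t) y)"

end

theory Submission
  imports Defs
begin

text \<open>
  Write \<open>c\<close> for the initial speed of the axis. The candidate steady solution is the initial profile
  carried along with speed \<open>c\<close>, that is, \<open>v(t, x, y) = u(0, x - c t, y)\<close>. If \<open>v\<close> solves the
  equation, then uniqueness gives \<open>u = v\<close>, and \<open>v\<close> is steady with speed \<open>c\<close>.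

  For a travelling profile every time derivative is \<open>- c\<close> times an \<open>x\<close>-derivative, so the equation
  for \<open>v\<close>, at every time, is a single equation for the profile \<open>u(0, \<cdot>, \<cdot>)\<close> that contains no time
  derivative. It is extracted from the equation for \<open>u\<close> at \<open>t = 0\<close>
  (\<open>steady_equation_at_time_0\<close>). Average that equation over a point \<open>x\<close> and its mirror image
  \<open>2 \<lambda>(0) - x\<close>. Since \<open>u\<close> is even about the axis, each further \<open>x\<close>-derivative flips the parity; hence
  \<open>3 u u\<^sub>x - \<gamma> (2 u\<^sub>x u\<^sub>x\<^sub>x + u u\<^sub>x\<^sub>x\<^sub>x)\<close> is odd, its \<open>x\<close>-derivative is even, and so are \<open>u\<^sub>y\<^sub>y\<close> and
  \<open>u\<^sub>x\<^sub>x\<^sub>y\<^sub>y\<close>: averaging leaves all of these unchanged. For the remaining terms, differentiate the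
  symmetry \<open>u(t, 2 \<lambda>(t) - x, y) = u(t, x, y)\<close> in time and then in \<open>x\<close>; at
  \<open>t = 0\<close> the motion of the axis contributes a term \<open>2 c u\<^sub>x\<close> to \<open>u\<^sub>t\<close>, and as a result the average of \<open>u\<^sub>t\<^sub>x\<close> is \<open>- c u\<^sub>x\<^sub>x\<close>
  (\<open>Dx_Dt_reflect\<close>). The same holds for \<open>u\<^sub>x\<^sub>x\<close> in place of \<open>u\<close>, since \<open>u\<^sub>x\<^sub>x\<close> has the same symmetry.
  The averaged equation is therefore exactly the profile equation.
\<close>

definition travelling :: "real \<Rightarrow> field3 \<Rightarrow> field3" where
  "travelling c f t x y = f 0 (x - c * t) y"

definition flux :: "real \<Rightarrow> field3 \<Rightarrow> field3" where
  "flux \<gamma> u t x y = 3 * u t x y * Dx u t x y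
     - \<gamma> * (2 * Dx u t x y * Dx (Dx u) t x y + u t x y * Dx (Dx (Dx u)) t x y)"

section \<open>Partial derivatives of fields\<close>

lemma has_Dx_DERIV:
  assumes "has_Dx T f" "t \<in> {0..T}"
  shows "((\<lambda>s. f t s y) has_real_derivative Dx f t x y) (at x)"
  using assms by (simp add: has_Dx_def Dx_def DERIV_deriv_iff_real_differentiable)

lemma has_Dx_I:
  assumes "\<And>t x y. t \<in> {0..T} \<Longrightarrow> ((\<lambda>s. f t s y) has_real_derivative D t x y) (at x)"
  shows "has_Dx T f" "\<And>t x y. t \<in> {0..T} \<Longrightarrow> Dx f t x y = D t x y"
proof -
  show "has_Dx T f"
    using assms unfolding has_Dx_def by (meson real_differentiable_def)
  show "Dx f t x y = D t x y" if "t \<in> {0..T}" for t x y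
    using assms[OF that] unfolding Dx_def by (rule DERIV_imp_deriv)
qed

lemma has_Dt_DERIV:
  assumes "has_Dt T f" "t \<in> {0..T}"
  shows "((\<lambda>s. f s x y) has_real_derivative Dt T f t x y) (at t within {0..T})"
  using assms
  by (simp add: has_Dt_def Dt_def has_real_derivative_iff_has_vector_derivative
      vector_derivative_works)

lemma Dt_eqI:
  assumes "0 < T" "t \<in> {0..T}"
    and "((\<lambda>s. f s x y) has_real_derivative D) (at t within {0..T})"
  shows "Dt T f t x y = D"
  using assms vector_derivative_within_closed_interval[of 0 T t "\<lambda>s. f s x y" D]
  by (simp add: Dt_def has_real_derivative_iff_has_vector_derivative)

lemma has_Dt_I:
  assumes "0 < T"
    and "\<And>t x y. t \<in> {0..T} \<Longrightarrow>
          ((\<lambda>s. f s x y) has_real_derivative D t x y) (at t within {0..T})"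
  shows "has_Dt T f" "\<And>t x y. t \<in> {0..T} \<Longrightarrow> Dt T f t x y = D t x y"
proof -
  show "has_Dt T f"
    using assms(2) unfolding has_Dt_def by (meson real_differentiable_def)
  show "Dt T f t x y = D t x y" if "t \<in> {0..T}" for t x y
    using Dt_eqI[OF assms(1) that assms(2)[OF that]] .
qed

lemma cont_cong:
  assumes "\<And>t x y. t \<in> {0..T} \<Longrightarrow> f t x y = g t x y"
  shows "cont T f = cont T g"
  unfolding cont_def using assms by (intro continuous_on_cong) auto

lemma cont_scale: "cont T f \<Longrightarrow> cont T (\<lambda>t x y. k * f t x y)"
  unfolding cont_def split_beta by (intro continuous_intros)

text \<open>
  The time derivative is only given for frozen spatial variables, so moving with the axis needs joint
  differentiability in \<open>(t, x)\<close>. It follows from the existence of both partial derivatives because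
  \<open>Dx f\<close> is continuous. At the endpoints of \<open>{0..T}\<close>, in particular at \<open>0\<close>, everything is one-sided.
\<close>

lemma DERIV_along_curve:
  assumes fT: "has_Dt T f" and fX: "has_Dx T f" and cX: "cont T (Dx f)"
    and t: "t \<in> {0..T}" and p: "(p has_real_derivative p') (at t within {0..T})"
  shows "((\<lambda>s. f s (p s) y) has_real_derivative
           Dt T f t (p t) y + Dx f t (p t) y * p') (at t within {0..T})"
proof -
  let ?I = "{0..T}"
  let ?D = "\<lambda>s x. blinfun_scaleR_left (Dx f s x y)"
  have cont2: "continuous_on (?I \<times> UNIV) (\<lambda>(s, x). Dx f s x y)"
  proof -
    have "continuous_on (?I \<times> UNIV) ((\<lambda>(t, x, y). Dx f t x y) \<circ> (\<lambda>(s, x). (s, x, y)))"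
      by (rule continuous_on_compose)
        (auto simp: split_beta intro!: continuous_intros continuous_on_subset[OF cX[unfolded cont_def split_beta]])
    then show ?thesis by (simp add: o_def split_beta)
  qed
  have "continuous (at (t, p t) within ?I \<times> UNIV) (\<lambda>(s, x). ?D s x)"
    using bounded_linear.continuous[OF bounded_linear_blinfun_scaleR_left,
        of _ "\<lambda>q. Dx f (fst q) (snd q) y"] cont2 t
    by (simp add: split_beta' continuous_on_eq_continuous_within)
  moreover have "((\<lambda>s. f s (p t) y) has_derivative (*) (Dt T f t (p t) y)) (at t within ?I)"
    using has_Dt_DERIV[OF fT t] by (simp add: has_field_derivative_def)
  moreover have "((\<lambda>x. f s x y) has_derivative blinfun_apply (?D s x)) (at x within UNIV)"
    if "s \<in> ?I" for s x
  proof -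
    have "blinfun_apply (?D s x) = (*) (Dx f s x y)"
      by (simp add: fun_eq_iff)
    then show ?thesis
      using has_Dx_DERIV[OF fX that, of y x] by (simp add: has_field_derivative_def)
  qed
  ultimately have joint: "((\<lambda>(s, x). f s x y) has_derivative
      (\<lambda>(h, k). Dt T f t (p t) y * h + blinfun_apply (?D t (p t)) k)) (at (t, p t) within ?I \<times> UNIV)"
    by (intro has_derivative_partialsI) auto
  have curve: "((\<lambda>s. (s, p s)) has_derivative (\<lambda>h. (h, p' * h))) (at t within ?I)"
    using p by (auto simp: has_field_derivative_def intro!: derivative_eq_intros)
  have "((\<lambda>(s, x). f s x y) \<circ> (\<lambda>s. (s, p s)) has_derivative
      (\<lambda>(h, k). Dt T f t (p t) y * h + blinfun_apply (?D t (p t)) k) \<circ> (\<lambda>h. (h, p' * h)))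
      (at t within ?I)"
    by (rule diff_chain_within[OF curve]) (rule has_derivative_subset[OF joint], auto)
  then have "((\<lambda>s. f s (p s) y) has_derivative
      (\<lambda>h. Dt T f t (p t) y * h + p' * h * Dx f t (p t) y)) (at t within ?I)"
    by (simp add: o_def)
  then show ?thesis
    unfolding has_field_derivative_def by (rule has_derivative_eq_rhs)
      (auto simp: fun_eq_iff algebra_simps)
qed

section \<open>Reflection about the axis\<close>

text \<open>
  The factor \<open>k\<close> is the parity: \<open>k = 1\<close> for functions that are even about \<open>a\<close>, \<open>k = - 1\<close> for odd ones.
\<close>

lemma Dx_reflect:
  assumes "has_Dx T f" "t \<in> {0..T}" and refl: "\<And>x. f t (2 * a - x) y = k * f t x y"
  shows "Dx f t (2 * a - x) y = - k * Dx f t x y"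
proof -
  have "((\<lambda>s. f t (2 * a - s) y) has_real_derivative Dx f t (2 * a - x) y * (-1)) (at x)"
    by (rule DERIV_chain2[OF has_Dx_DERIV[OF assms(1,2)]]) (auto intro!: derivative_eq_intros)
  moreover have "((\<lambda>s. f t (2 * a - s) y) has_real_derivative k * Dx f t x y) (at x)"
    unfolding refl by (rule DERIV_cmult[OF has_Dx_DERIV[OF assms(1,2)]])
  ultimately show ?thesis
    using DERIV_unique by fastforce
qed

text \<open>
  Since the axis moves, \<open>Dt T f\<close> does not inherit the symmetry of \<open>f\<close>: the mirror image of a resting
  point has velocity \<open>2 c\<close>, which produces the additional transport term.
\<close>

lemma Dt_reflect:
  assumes "0 < T" and fT: "has_Dt T f" and fX: "has_Dx T f" and cX: "cont T (Dx f)"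
    and t: "t \<in> {0..T}" and ax: "(ax has_real_derivative c) (at t within {0..T})"
    and refl: "\<And>s x y. s \<in> {0..T} \<Longrightarrow> f s (2 * ax s - x) y = f s x y"
  shows "Dt T f t (2 * ax t - x) y = Dt T f t x y + 2 * c * Dx f t x y"
proof -
  have "((\<lambda>s. f s (2 * ax s - x) y) has_real_derivative
      Dt T f t (2 * ax t - x) y + Dx f t (2 * ax t - x) y * (2 * c)) (at t within {0..T})"
    by (rule DERIV_along_curve[OF fT fX cX t]) (auto intro!: derivative_eq_intros ax)
  then have "((\<lambda>s. f s x y) has_real_derivative
      Dt T f t (2 * ax t - x) y + Dx f t (2 * ax t - x) y * (2 * c)) (at t within {0..T})"
    by (rule has_field_derivative_transform_within[OF _ zero_less_one t]) (simp add: refl)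
  then have "Dt T f t x y = Dt T f t (2 * ax t - x) y + Dx f t (2 * ax t - x) y * (2 * c)"
    by (rule Dt_eqI[OF \<open>0 < T\<close> t])
  moreover have "Dx f t (2 * ax t - x) y = - Dx f t x y"
    using Dx_reflect[OF fX t, of "ax t" y 1 x] refl[OF t] by simp
  ultimately show ?thesis by simp
qed

text \<open>
  This is where the speed enters: in the mirror average, the mixed derivative is what it would be for
  a profile that travels with the speed of the axis.
\<close>

lemma Dx_Dt_reflect:
  assumes "0 < T" and fT: "has_Dt T f" and fX: "has_Dx T f" and cX: "cont T (Dx f)"
    and ftX: "has_Dx T (Dt T f)" and fXX: "has_Dx T (Dx f)"
    and t: "t \<in> {0..T}" and ax: "(ax has_real_derivative c) (at t within {0..T})"
    and refl: "\<And>s x y. s \<in> {0..T} \<Longrightarrow> f s (2 * ax s - x) y = f s x y"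
  shows "Dx (Dt T f) t x y + Dx (Dt T f) t (2 * ax t - x) y = - 2 * c * Dx (Dx f) t x y"
proof -
  have "((\<lambda>s. Dt T f t (2 * ax t - s) y) has_real_derivative
      Dx (Dt T f) t (2 * ax t - x) y * (-1)) (at x)"
    by (rule DERIV_chain2[OF has_Dx_DERIV[OF ftX t]]) (auto intro!: derivative_eq_intros)
  moreover have "((\<lambda>s. Dt T f t (2 * ax t - s) y) has_real_derivative
      Dx (Dt T f) t x y + 2 * c * Dx (Dx f) t x y) (at x)"
  proof -
    have eq: "Dt T f t (2 * ax t - s) y = Dt T f t s y + 2 * c * Dx f t s y" for s
      by (rule Dt_reflect[where ax = ax, OF assms(1) fT fX cX t ax]) (rule refl)
    show ?thesis
      unfolding eq by (intro DERIV_add DERIV_cmult has_Dx_DERIV[OF _ t] ftX fXX)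
  qed
  ultimately show ?thesis
    using DERIV_unique by fastforce
qed

section \<open>Travelling profiles\<close>

lemma Dx_travelling: "Dx (travelling c f) = travelling c (Dx f)"
proof (intro ext)
  fix t x y
  have "(\<lambda>s. f 0 (s - c * t) y) = (\<lambda>s. f 0 (- (c * t) + s) y)"
    by (simp add: algebra_simps)
  then show "Dx (travelling c f) t x y = travelling c (Dx f) t x y"
    using DERIV_shift[of "\<lambda>s. f 0 s y" _ x "- (c * t)"]
    by (simp add: Dx_def travelling_def deriv_def)
qed

lemma Dy_travelling: "Dy (travelling c f) = travelling c (Dy f)"
  by (intro ext) (simp add: Dy_def travelling_def)

lemma flux_travelling: "flux \<gamma> (travelling c u) = travelling c (flux \<gamma> u)"
  by (intro ext) (simp add: flux_def Dx_travelling, simp add: travelling_def flux_def)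

lemma has_Dx_travelling:
  assumes "0 < T" "has_Dx T f"
  shows "has_Dx T (travelling c f)"
proof (rule has_Dx_I(1))
  fix t x y
  show "((\<lambda>s. travelling c f t s y) has_real_derivative Dx f 0 (x - c * t) y * 1) (at x)"
    unfolding travelling_def
    using assms by (intro DERIV_chain2[OF has_Dx_DERIV]) (auto intro!: derivative_eq_intros)
qed

lemma has_Dy_travelling: "0 < T \<Longrightarrow> has_Dy T f \<Longrightarrow> has_Dy T (travelling c f)"
  by (simp add: has_Dy_def travelling_def)

lemma
  assumes "0 < T" "has_Dx T f"
  shows has_Dt_travelling: "has_Dt T (travelling c f)"
    and Dt_travelling: "\<And>t x y. t \<in> {0..T} \<Longrightarrow>
      Dt T (travelling c f) t x y = - c * travelling c (Dx f) t x y"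
proof -
  have D: "((\<lambda>s. travelling c f s x y) has_real_derivative - c * travelling c (Dx f) t x y)
      (at t within {0..T})" for t x y
  proof -
    have "((\<lambda>s. f 0 (x - c * s) y) has_real_derivative Dx f 0 (x - c * t) y * (- c))
        (at t within {0..T})"
      using assms by (intro DERIV_chain2[OF has_Dx_DERIV]) (auto intro!: derivative_eq_intros)
    then show ?thesis by (simp add: travelling_def mult.commute)
  qed
  show "has_Dt T (travelling c f)"
    by (rule has_Dt_I(1)[OF assms(1) D])
  show "Dt T (travelling c f) t x y = - c * travelling c (Dx f) t x y" if "t \<in> {0..T}" for t x y
    by (rule has_Dt_I(2)[OF assms(1) D that])
qed

lemma cont_travelling:
  assumes "0 < T" "cont T f"
  shows "cont T (travelling c f)"
proof -
  have "continuous_on ({0..T} \<times> UNIV) ((\<lambda>(t, x, y). f t x y) \<circ> (\<lambda>(t, x, y). (0, x - c * t, y)))"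
    using assms unfolding cont_def split_beta
    by (intro continuous_on_compose continuous_intros) (auto elim!: continuous_on_subset)
  then show ?thesis by (simp add: cont_def o_def split_beta travelling_def)
qed

lemma Dx_Dt_travelling:
  assumes "0 < T" "has_Dx T f" "has_Dx T (Dx f)"
  shows "has_Dx T (Dt T (travelling c f))"
    and "\<And>t x y. t \<in> {0..T} \<Longrightarrow>
      Dx (Dt T (travelling c f)) t x y = - c * travelling c (Dx (Dx f)) t x y"
proof -
  have D: "((\<lambda>s. Dt T (travelling c f) t s y) has_real_derivative
      - c * travelling c (Dx (Dx f)) t x y) (at x)" if "t \<in> {0..T}" for t x y
    unfolding Dt_travelling[OF assms(1,2) that] Dx_travelling[symmetric]
    by (intro DERIV_cmult has_Dx_DERIV[OF _ that])
      (simp add: Dx_travelling has_Dx_travelling assms)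
  show "has_Dx T (Dt T (travelling c f))"
    by (rule has_Dx_I(1)[OF D])
  show "Dx (Dt T (travelling c f)) t x y = - c * travelling c (Dx (Dx f)) t x y"
    if "t \<in> {0..T}" for t x y
    by (rule has_Dx_I(2)[OF D that])
qed

text \<open>
  A time derivative of the travelling profile costs one \<open>x\<close>-derivative of \<open>u\<close>, so the most demanding
  term \<open>u\<^sub>x\<^sub>x\<^sub>t\<^sub>x\<close> requires \<open>u\<^sub>x\<^sub>x\<^sub>x\<^sub>x\<close>, which a classical solution possesses for the sake of the term
  \<open>\<gamma> u u\<^sub>x\<^sub>x\<^sub>x\<close> under the outer derivative.
\<close>

lemma classical_regularity_travelling:
  assumes "0 < T" and reg: "classical_regularity T u"
  shows "classical_regularity T (travelling c u)"
proof -
  have Dt_cont: "cont T (Dt T (travelling c f))" if "has_Dx T f" "cont T (Dx f)" for f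
    by (subst cont_cong[OF Dt_travelling[OF assms(1) that(1)]], assumption)
      (rule cont_scale[OF cont_travelling[OF assms(1) that(2)]])
  have DxDt_cont: "cont T (Dx (Dt T (travelling c f)))"
    if "has_Dx T f" "has_Dx T (Dx f)" "cont T (Dx (Dx f))" for f
    by (subst cont_cong[OF Dx_Dt_travelling(2)[OF assms(1) that(1,2)]], assumption)
      (rule cont_scale[OF cont_travelling[OF assms(1) that(3)]])
  show ?thesis
    using reg assms(1)
    by (simp add: classical_regularity_def Dx_travelling Dy_travelling cont_travelling
        has_Dx_travelling has_Dy_travelling has_Dt_travelling Dx_Dt_travelling(1)
        Dt_cont DxDt_cont)
qed

section \<open>The equation\<close>

lemma has_Dx_flux:
  assumes "classical_regularity T u"
  shows "has_Dx T (flux \<gamma> u)"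
  using assms unfolding classical_regularity_def has_Dx_def flux_def
  by (auto intro!: derivative_intros)

text \<open>
  The equation is stated with one outer \<open>x\<close>-derivative of a sum. The parity argument treats the time
  derivatives and the flux differently, so the sum has to be split; the regularity assumptions
  provide each of the derivatives that arise.
\<close>

lemma plate_equation_expanded:
  assumes reg: "classical_regularity T u" and t: "t \<in> {0..T}"
  shows "plate_equation_at \<alpha> \<beta> \<gamma> T u t x y \<longleftrightarrow>
    Dx (Dt T u) t x y - Dx (Dt T (Dx (Dx u))) t x y + Dx (flux \<gamma> u) t x y
      - \<alpha> * Dy (Dy u) t x y + \<beta> * Dy (Dy (Dx (Dx u))) t x y = 0"
proof -
  have "((\<lambda>s. Dt T u t s y - Dt T (Dx (Dx u)) t s y + flux \<gamma> u t s y) has_real_derivative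
      Dx (Dt T u) t x y - Dx (Dt T (Dx (Dx u))) t x y + Dx (flux \<gamma> u) t x y) (at x)"
    using reg by (intro DERIV_add DERIV_diff has_Dx_DERIV[OF _ t] has_Dx_flux)
      (auto simp: classical_regularity_def)
  then have "deriv (\<lambda>s. Dt T u t s y - Dt T (Dx (Dx u)) t s y + flux \<gamma> u t s y) x =
      Dx (Dt T u) t x y - Dx (Dt T (Dx (Dx u))) t x y + Dx (flux \<gamma> u) t x y"
    by (rule DERIV_imp_deriv)
  \<comment> \<open>The instance restricts unfolding to the outermost derivative; the inner ones stay folded.\<close>
  then show ?thesis
    by (simp add: plate_equation_at_def flux_def add_diff_eq
        Dx_def[of "\<lambda>t x y. _ t x y - _ t x y + _ t x y - _ t x y"])
qed

text \<open>
  The equation for \<open>u\<close> at time \<open>0\<close>, averaged over the points \<open>x\<close> and \<open>2 * ax 0 - x\<close>. The average has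
  no time derivatives left, hence is a condition on the initial profile alone, and it is the equation
  of a profile travelling with speed \<open>c\<close>.
\<close>

lemma steady_equation_at_time_0:
  assumes "0 < T" and sol: "classical_solution \<alpha> \<beta> \<gamma> T u"
    and ax: "(ax has_real_derivative c) (at 0)"
    and sym: "\<And>t x y. t \<in> {0..T} \<Longrightarrow> u t (2 * ax t - x) y = u t x y"
  shows "- c * Dx (Dx u) 0 x y + c * Dx (Dx (Dx (Dx u))) 0 x y + Dx (flux \<gamma> u) 0 x y
      - \<alpha> * Dy (Dy u) 0 x y + \<beta> * Dy (Dy (Dx (Dx u))) 0 x y = 0"
proof -
  have reg: "classical_regularity T u" and
    eq: "\<And>x. plate_equation_at \<alpha> \<beta> \<gamma> T u 0 x y"
    using sol \<open>0 < T\<close> by (auto simp: classical_solution_def)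
  have 0: "0 \<in> {0..T}" using \<open>0 < T\<close> by simp
  note R = reg[unfolded classical_regularity_def]
  let ?r = "\<lambda>x. 2 * ax 0 - x"
  have ux: "Dx u t (2 * ax t - x) y = - Dx u t x y" if "t \<in> {0..T}" for t x y
    using Dx_reflect[of T u t "ax t" y 1 x] R sym that by simp
  have uxx: "Dx (Dx u) t (2 * ax t - x) y = Dx (Dx u) t x y" if "t \<in> {0..T}" for t x y
    using Dx_reflect[of T "Dx u" t "ax t" y "-1" x] R ux that by simp
  have uxxx: "Dx (Dx (Dx u)) t (2 * ax t - x) y = - Dx (Dx (Dx u)) t x y" if "t \<in> {0..T}" for t x y
    using Dx_reflect[of T "Dx (Dx u)" t "ax t" y 1 x] R uxx that by simp
  have "flux \<gamma> u 0 (?r x) y = - 1 * flux \<gamma> u 0 x y" for x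
    by (simp only: flux_def sym[OF 0] ux[OF 0] uxx[OF 0] uxxx[OF 0]) (simp add: algebra_simps)
  then have N: "Dx (flux \<gamma> u) 0 (?r x) y = Dx (flux \<gamma> u) 0 x y"
    using Dx_reflect[OF has_Dx_flux[OF reg] 0, of _ "ax 0" y "-1" x] by simp
  have uyy: "Dy (Dy u) 0 (?r x) y = Dy (Dy u) 0 x y"
    using 0 by (simp add: Dy_def sym)
  have uxxyy: "Dy (Dy (Dx (Dx u))) 0 (?r x) y = Dy (Dy (Dx (Dx u))) 0 x y"
    using 0 by (simp add: Dy_def uxx)
  \<comment> \<open>Only the right-sided time derivative at \<open>0\<close> is available for the field.\<close>
  note ax' = has_field_derivative_at_within[OF ax, of "{0..T}"]
  have utx: "Dx (Dt T u) 0 x y + Dx (Dt T u) 0 (?r x) y = - 2 * c * Dx (Dx u) 0 x y"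
    by (rule Dx_Dt_reflect[OF \<open>0 < T\<close> _ _ _ _ _ 0 ax']) (use R sym in auto)
  have uxxtx: "Dx (Dt T (Dx (Dx u))) 0 x y + Dx (Dt T (Dx (Dx u))) 0 (?r x) y =
      - 2 * c * Dx (Dx (Dx (Dx u))) 0 x y"
    by (rule Dx_Dt_reflect[OF \<open>0 < T\<close> _ _ _ _ _ 0 ax']) (use R uxx in auto)
  note E = eq[unfolded plate_equation_expanded[OF reg 0]]
  \<comment> \<open>Half the sum of the equations at the two mirror points.\<close>
  from E[of x] E[of "?r x"] utx uxxtx show ?thesis
    unfolding N uyy uxxyy by linarith
qed

theorem theorem2:
  fixes \<alpha> \<beta> \<gamma> T :: real
    and u0 :: "real \<Rightarrow> real \<Rightarrow> real"
    and u :: "real \<Rightarrow> real \<Rightarrow> real \<Rightarrow> real"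
    and ax :: "real \<Rightarrow> real"
  assumes "\<alpha> \<ge> 0" and "\<beta> \<ge> 0" and "\<gamma> \<ge> 0" and "T > 0"
    and "unique_classical_solution \<alpha> \<beta> \<gamma> T u0 u"
    and "x_symmetric_with_axis T u ax"
  shows "steady_in_x T u (deriv ax 0)"
proof -
  let ?c = "deriv ax 0"
  let ?v = "travelling ?c u"
  have sol: "classical_solution \<alpha> \<beta> \<gamma> T u" and init: "\<And>x y. u 0 x y = u0 x y"
    and unique: "\<And>v. classical_solution \<alpha> \<beta> \<gamma> T v \<and> (\<forall>x y. v 0 x y = u0 x y) \<longrightarrow>
      (\<forall>t\<in>{0..T}. \<forall>x y. v t x y = u t x y)"
    using assms(5) by (simp_all add: unique_classical_solution_def)
  have sym: "u t (2 * ax t - x) y = u t x y" if "t \<in> {0..T}" for t x y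
    using assms(6) that unfolding x_symmetric_with_axis_def by metis
  have "ax differentiable (at 0)"
    using assms(6) unfolding x_symmetric_with_axis_def C1_differentiable_on_eq by blast
  then have ax: "(ax has_real_derivative ?c) (at 0)"
    by (simp add: DERIV_deriv_iff_real_differentiable)
  have reg: "classical_regularity T u"
    using sol by (simp add: classical_solution_def)
  have vreg: "classical_regularity T ?v"
    by (rule classical_regularity_travelling[OF \<open>T > 0\<close> reg])
  have "plate_equation_at \<alpha> \<beta> \<gamma> T ?v t x y" if t: "t \<in> {0..T}" for t x y
  proof -
    have "Dx (Dt T ?v) t x y = - ?c * travelling ?c (Dx (Dx u)) t x y"
      using reg by (intro Dx_Dt_travelling(2) \<open>T > 0\<close> t) (auto simp: classical_regularity_def)
    moreover have "Dx (Dt T (travelling ?c (Dx (Dx u)))) t x y =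
        - ?c * travelling ?c (Dx (Dx (Dx (Dx u)))) t x y"
      using reg by (intro Dx_Dt_travelling(2) \<open>T > 0\<close> t) (auto simp: classical_regularity_def)
    ultimately show ?thesis
      using steady_equation_at_time_0[OF \<open>T > 0\<close> sol ax sym, of "x - ?c * t" y]
      unfolding plate_equation_expanded[OF vreg t] flux_travelling Dx_travelling Dy_travelling
      by (simp add: travelling_def)
  qed
  then have "classical_solution \<alpha> \<beta> \<gamma> T ?v"
    using vreg by (simp add: classical_solution_def)
  then have "\<forall>t\<in>{0..T}. \<forall>x y. ?v t x y = u t x y"
    using unique[of ?v] by (simp add: travelling_def init)
  then have "\<forall>t\<in>{0..T}. \<forall>x y. u t x y = u 0 (x - ?c * t) y"
    by (simp add: travelling_def)
  then show ?thesis
    unfolding steady_in_x_def by blast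
qed

end
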